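(* Consider a contextual game with $N$ players, finite action sets $\mathcal{A}^1,\dots,\mathcal{A}^N$, context set $\mathcal{Z}$ and reward functions $r^i:\boldsymbol{\mathcal{A}}\times\mathcal{Z}\to[0,1]$. After $T$ game rounds, in which contexts $z_1,\dots,z_T$ were revealed and joint actions $\mathbf{a}_t=(a_t^i,a_t^{-i})$, $t=1,\dots,T$, were played, let $R_c^i(T)$, $i=1,\dots,N$, denote the players' contextual regrets and $\rho_T$ the empirical policy at round $T$. Then $\rho_T$ is an $\epsilon$-c-CCE of the played contextual game with $$\epsilon\le\max_{i\in\{1,\dots,N\}}\frac{R_c^i(T)}{T}.$$
   Context: $\boldsymbol{\mathcal{A}}=\mathcal{A}^1\times\dots\times\mathcal{A}^N$ is the joint action space, $\mathbf{a}=(a^i,a^{-i})$ where $a^{-i}$ are the actions of the players other than $i$, and $\Delta^{|\boldsymbol{\mathcal{A}}|}$ is the set of probability distributions on $\boldsymbol{\mathcal{A}}$. Contextual regret of player $i$: $R_c^i(T)=\max_{\pi:\mathcal{Z}\to\mathcal{A}^i}\sum_{t=1}^T r^i(\pi(z_t),a_t^{-i},z_t)-\sum_{t=1}^T r^i(a_t^i,a_t^{-i},z_t)$. Contextual coarse correlated equilibrium (c-CCE) of the contextual game described by contexts $z_1,\dots,z_T$: a policy $\rho:\mathcal{Z}\to\Delta^{|\boldsymbol{\mathcal{A}}|}$ such that $$\frac1T\sum_{t=1}^T\mathop{\mathbb{E}}_{\mathbf{a}\sim\rho(z_t)}r^i(\mathbf{a},z_t)\ \ge\ \frac1T\sum_{t=1}^T\mathop{\mathbb{E}}_{\mathbf{a}\sim\rho(z_t)}r^i(\pi(z_t),a^{-i},z_t)\qquad\text{for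 all }\pi:\mathcal{Z}\to\mathcal{A}^i\text{ and all }i=1,\dots,N.$$ The policy $\rho$ is an $\epsilon$-c-CCE if this inequality is satisfied up to an $\epsilon\in\mathbb{R}_+$ accuracy (i.e. with $\epsilon$ subtracted from the right-hand side). Empirical policy at round $T$: the policy $\rho_T:\mathcal{Z}\to\Delta^{|\boldsymbol{\mathcal{A}}|}$ such that for each context $z$ among $z_1,\dots,z_T$, $\rho_T(z)$ is the empirical distribution of the joint actions played in the rounds $t\le T$ with $z_t=z$, while for every other $z\in\mathcal{Z}$, $\rho_T(z)$ is an arbitrary (e.g. uniform) distribution.
   Formalization: The maximum of R_c^i(T)/T can be negative, and then no nonnegative ε below it exists; the formal claim with ε ≥ 0 assumes this maximum is nonnegative, and in general the equilibrium inequality is proved with a real, possibly negative, ε at most the maximum. *)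

theory Defs
  imports "HOL-Probability.Probability"
begin

text \<open>
  Players are \<open>1, \<dots>, N\<close>; \<open>A i\<close> is the action set of player \<open>i\<close>, all of them inside one type \<open>'a\<close>;
  \<open>Z\<close> is the context set. The reward \<open>r\<^sup>i(a\<^sup>i, a\<^sup>-\<^sup>i, z)\<close> is \<open>r i a z\<close>, and
  \<open>r\<^sup>i(b, a\<^sup>-\<^sup>i, z)\<close> is \<open>r i (a(i := b)) z\<close>.
  Rounds are \<open>1, \<dots>, T\<close>, with context \<open>z t\<close> and joint action \<open>a t\<close> in round \<open>t\<close>.
\<close>

definition joint_actions :: "nat \<Rightarrow> (nat \<Rightarrow> 'a set) \<Rightarrow> (nat \<Rightarrow> 'a) set" where
  "joint_actions N A = (\<Pi>\<^sub>E i\<in>{1..N}. A i)"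

text \<open>
  The set of policies may be infinite, but the set of cumulative rewards below is finite when
  \<open>A i\<close> is finite, since only the values at the contexts \<open>z 1, \<dots>, z T\<close> matter.
\<close>

definition contextual_regret ::
  "(nat \<Rightarrow> 'a set) \<Rightarrow> 'z set \<Rightarrow> (nat \<Rightarrow> (nat \<Rightarrow> 'a) \<Rightarrow> 'z \<Rightarrow> real) \<Rightarrow>
   (nat \<Rightarrow> 'z) \<Rightarrow> (nat \<Rightarrow> nat \<Rightarrow> 'a) \<Rightarrow> nat \<Rightarrow> nat \<Rightarrow> real" where
  "contextual_regret A Z r z a i T =
     Max {(\<Sum>t=1..T. r i ((a t)(i := \<pi> (z t))) (z t)) |\<pi>. \<pi> \<in> Z \<rightarrow> A i}
     - (\<Sum>t=1..T. r i (a t) (z t))"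

definition joint_policy ::
  "nat \<Rightarrow> (nat \<Rightarrow> 'a set) \<Rightarrow> 'z set \<Rightarrow> ('z \<Rightarrow> (nat \<Rightarrow> 'a) pmf) \<Rightarrow> bool" where
  "joint_policy N A Z \<rho> \<longleftrightarrow> (\<forall>x\<in>Z. set_pmf (\<rho> x) \<subseteq> joint_actions N A)"

text \<open>
  The equilibrium condition with an arbitrary real slack. The sign of the slack is unrestricted
  because contextual regrets, and even their maximum over the players, can be negative.
\<close>

definition c_CCE_with_slack ::
  "nat \<Rightarrow> (nat \<Rightarrow> 'a set) \<Rightarrow> 'z set \<Rightarrow> (nat \<Rightarrow> (nat \<Rightarrow> 'a) \<Rightarrow> 'z \<Rightarrow> real) \<Rightarrow>
   (nat \<Rightarrow> 'z) \<Rightarrow> nat \<Rightarrow> real \<Rightarrow> ('z \<Rightarrow> (nat \<Rightarrow> 'a) pmf) \<Rightarrow> bool" where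
  "c_CCE_with_slack N A Z r z T \<epsilon> \<rho> \<longleftrightarrow>
     joint_policy N A Z \<rho> \<and>
     (\<forall>i\<in>{1..N}. \<forall>\<pi>\<in>Z \<rightarrow> A i.
        1 / real T * (\<Sum>t=1..T. measure_pmf.expectation (\<rho> (z t)) (\<lambda>b. r i b (z t)))
        \<ge> 1 / real T * (\<Sum>t=1..T. measure_pmf.expectation (\<rho> (z t))
                            (\<lambda>b. r i (b(i := \<pi> (z t))) (z t))) - \<epsilon>)"

definition eps_c_CCE ::
  "nat \<Rightarrow> (nat \<Rightarrow> 'a set) \<Rightarrow> 'z set \<Rightarrow> (nat \<Rightarrow> (nat \<Rightarrow> 'a) \<Rightarrow> 'z \<Rightarrow> real) \<Rightarrow>
   (nat \<Rightarrow> 'z) \<Rightarrow> nat \<Rightarrow> real \<Rightarrow> ('z \<Rightarrow> (nat \<Rightarrow> 'a) pmf) \<Rightarrow> bool" where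
  "eps_c_CCE N A Z r z T \<epsilon> \<rho> \<longleftrightarrow> 0 \<le> \<epsilon> \<and> c_CCE_with_slack N A Z r z T \<epsilon> \<rho>"

text \<open>
  The values of an empirical policy at unobserved contexts are arbitrary distributions on joint
  actions, so this is a predicate. At an observed context \<open>x\<close> the value is the law of \<open>a t\<close> for
  \<open>t\<close> uniform among the rounds with context \<open>x\<close>.
\<close>

definition empirical_policy ::
  "nat \<Rightarrow> (nat \<Rightarrow> 'a set) \<Rightarrow> 'z set \<Rightarrow> (nat \<Rightarrow> 'z) \<Rightarrow> (nat \<Rightarrow> nat \<Rightarrow> 'a) \<Rightarrow> nat \<Rightarrow>
   ('z \<Rightarrow> (nat \<Rightarrow> 'a) pmf) \<Rightarrow> bool" where
  "empirical_policy N A Z z a T \<rho> \<longleftrightarrow>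
     joint_policy N A Z \<rho> \<and>
     (\<forall>x\<in>z ` {1..T}. \<rho> x = map_pmf a (pmf_of_set {t\<in>{1..T}. z t = x}))"

end

theory Submission
  imports Defs
begin

text \<open>
  Averaging over the rounds with a given context and then summing over all rounds counts every
  round exactly once. Hence the total expected reward under the empirical policy is the total
  reward collected in play, both for the played actions and after a deviation of one player, and
  the equilibrium gap of player \<open>i\<close> for a deviation \<open>\<pi>\<close> is the summand of the regret at \<open>\<pi>\<close>,
  divided by \<open>T\<close>.
\<close>

text \<open>After the two sums are exchanged, \<open>g s\<close> occurs once for each
  \<open>t\<close> in the fiber of \<open>s\<close>, each time with weight one over the size of that
  same fiber, so the weights add up to 1.\<close>

lemma sum_fiber_averages:
  fixes g :: "'b \<Rightarrow> 'c :: field_char_0"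
  assumes "finite I"
  shows "(\<Sum>t\<in>I. (\<Sum>s | s \<in> I \<and> f s = f t. g s) / of_nat (card {s \<in> I. f s = f t})) = sum g I"
proof -
  have "(\<Sum>t\<in>I. (\<Sum>s | s \<in> I \<and> f s = f t. g s) / of_nat (card {s \<in> I. f s = f t}))
      = (\<Sum>t\<in>I. \<Sum>s | s \<in> I \<and> f s = f t. g s / of_nat (card {u \<in> I. f u = f t}))"
    by (simp add: sum_divide_distrib)
  also have "\<dots> = (\<Sum>s\<in>I. \<Sum>t | t \<in> I \<and> f s = f t. g s / of_nat (card {u \<in> I. f u = f t}))"
    using assms by (intro sum.swap_restrict)
  also have "\<dots> = (\<Sum>s\<in>I. \<Sum>t | t \<in> I \<and> f t = f s. g s / of_nat (card {u \<in> I. f u = f s}))"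
    by (intro sum.cong) auto
  also have "\<dots> = sum g I"
  proof (intro sum.cong refl)
    fix s assume "s \<in> I"
    \<comment> \<open>The fiber contains \<open>s\<close> itself, so the cardinality
      cancels.\<close>
    then have "card {u \<in> I. f u = f s} \<noteq> 0"
      using assms by auto
    then show "(\<Sum>t | t \<in> I \<and> f t = f s. g s / of_nat (card {u \<in> I. f u = f s})) = g s"
      by simp
  qed
  finally show ?thesis .
qed

text \<open>The integrand \<open>g\<close> takes the context as an argument so that rewards after a
  deviation \<pi>, which depends on the context, are also an instance.\<close>

lemma sum_expectation_empirical_policy:
  fixes g :: "'z \<Rightarrow> (nat \<Rightarrow> 'a) \<Rightarrow> real"
  assumes "empirical_policy N A Z z a T \<rho>"
  shows "(\<Sum>t=1..T. measure_pmf.expectation (\<rho> (z t)) (g (z t))) = (\<Sum>t=1..T. g (z t) (a t))"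
proof -
  \<comment> \<open>On the fiber \<open>z s = z t\<close>, so \<open>g (z t)\<close> may be replaced
    by \<open>g (z s)\<close>; the summand then depends on \<open>s\<close> alone, as fiber
    averaging requires.\<close>
  have "measure_pmf.expectation (\<rho> (z t)) (g (z t))
      = (\<Sum>s | s \<in> {1..T} \<and> z s = z t. g (z s) (a s)) / real (card {s \<in> {1..T}. z s = z t})"
    if "t \<in> {1..T}" for t
  proof -
    have "\<rho> (z t) = map_pmf a (pmf_of_set {s \<in> {1..T}. z s = z t})"
      using assms that unfolding empirical_policy_def by blast
    moreover have "{s \<in> {1..T}. z s = z t} \<noteq> {}"
      using that by auto
    ultimately show ?thesis
      by (simp add: integral_pmf_of_set)
  qed
  then show ?thesis
    using sum_fiber_averages[of "{1..T}" "\<lambda>s. g (z s) (a s)" z]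
    by (simp cong: sum.cong_simp del: atLeastAtMost_iff)
qed

text \<open>A value depends on \<pi> only through the finitely many choices
  \<open>\<pi> (z t)\<close>. The bounding set also admits choices that differ between rounds with
  equal contexts, hence an inclusion only.\<close>

lemma finite_policy_values:
  assumes "finite I" and "finite B" and "z ` I \<subseteq> Z"
  shows "finite {(\<Sum>t\<in>I. F t (\<pi> (z t))) |\<pi>. \<pi> \<in> Z \<rightarrow> B}"
proof (rule finite_subset)
  show "{(\<Sum>t\<in>I. F t (\<pi> (z t))) |\<pi>. \<pi> \<in> Z \<rightarrow> B} \<subseteq> (\<lambda>p. \<Sum>t\<in>I. F t (p t)) ` (\<Pi>\<^sub>E t\<in>I. B)"
  proof clarify
    fix \<pi> assume "\<pi> \<in> Z \<rightarrow> B"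
    with assms(3) have "restrict (\<pi> \<circ> z) I \<in> (\<Pi>\<^sub>E t\<in>I. B)"
      by (auto simp: image_subset_iff)
    moreover have "(\<Sum>t\<in>I. F t (\<pi> (z t))) = (\<Sum>t\<in>I. F t (restrict (\<pi> \<circ> z) I t))"
      by simp
    ultimately show "(\<Sum>t\<in>I. F t (\<pi> (z t))) \<in> (\<lambda>p. \<Sum>t\<in>I. F t (p t)) ` (\<Pi>\<^sub>E t\<in>I. B)"
      by blast
  qed
  show "finite ((\<lambda>p. \<Sum>t\<in>I. F t (p t)) ` (\<Pi>\<^sub>E t\<in>I. B))"
    using assms by (intro finite_imageI finite_PiE)
qed

lemma contextual_regret_ge:
  assumes "finite (A i)" and "z ` {1..T} \<subseteq> Z" and "\<pi> \<in> Z \<rightarrow> A i"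
  shows "(\<Sum>t=1..T. r i ((a t)(i := \<pi> (z t))) (z t)) - (\<Sum>t=1..T. r i (a t) (z t))
    \<le> contextual_regret A Z r z a i T"
proof -
  \<comment> \<open>Finiteness makes \<open>Max\<close> in the regret a genuine upper bound.\<close>
  have "finite {(\<Sum>t=1..T. r i ((a t)(i := \<pi> (z t))) (z t)) |\<pi>. \<pi> \<in> Z \<rightarrow> A i}"
    using assms by (intro finite_policy_values) auto
  with assms(3) show ?thesis
    unfolding contextual_regret_def by (intro diff_right_mono Max_ge) auto
qed

theorem proposition4:
  fixes N T :: nat
    and A :: "nat \<Rightarrow> 'a set"
    and Z :: "'z set"
    and r :: "nat \<Rightarrow> (nat \<Rightarrow> 'a) \<Rightarrow> 'z \<Rightarrow> real"
    and z :: "nat \<Rightarrow> 'z"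
    and a :: "nat \<Rightarrow> nat \<Rightarrow> 'a"
    and \<rho> :: "'z \<Rightarrow> (nat \<Rightarrow> 'a) pmf"
  assumes "N \<ge> 1" and "T \<ge> 1"
    and "\<And>i. i \<in> {1..N} \<Longrightarrow> finite (A i)"
    and "\<And>i b x. i \<in> {1..N} \<Longrightarrow> b \<in> joint_actions N A \<Longrightarrow> x \<in> Z \<Longrightarrow> r i b x \<in> {0..1}"
    and "\<And>t. t \<in> {1..T} \<Longrightarrow> z t \<in> Z"
    and "\<And>t. t \<in> {1..T} \<Longrightarrow> a t \<in> joint_actions N A"
    and "empirical_policy N A Z z a T \<rho>"
  defines "M \<equiv> Max ((\<lambda>i. contextual_regret A Z r z a i T / real T) ` {1..N})"
  shows "(0 \<le> M \<longrightarrow> (\<exists>\<epsilon>. eps_c_CCE N A Z r z T \<epsilon> \<rho> \<and> \<epsilon> \<le> M)) \<and>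
         (\<exists>\<epsilon>. c_CCE_with_slack N A Z r z T \<epsilon> \<rho> \<and> \<epsilon> \<le> M)"
proof -
  \<comment> \<open>The witness for both conjuncts is \<open>M\<close> itself;
    \<open>0 \<le> M\<close> only supplies the sign condition of \<open>eps_c_CCE\<close>.\<close>
  have "c_CCE_with_slack N A Z r z T M \<rho>"
    unfolding c_CCE_with_slack_def
  proof (intro conjI ballI)
    show "joint_policy N A Z \<rho>"
      using assms(7) by (simp add: empirical_policy_def)
  next
    fix i \<pi> assume i: "i \<in> {1..N}" and \<pi>: "\<pi> \<in> Z \<rightarrow> A i"
    have "z ` {1..T} \<subseteq> Z"
      using assms(5) by blast
    then have "1 / real T * (\<Sum>t=1..T. r i ((a t)(i := \<pi> (z t))) (z t))
        - 1 / real T * (\<Sum>t=1..T. r i (a t) (z t)) \<le> contextual_regret A Z r z a i T / real T"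
      using contextual_regret_ge[of A i z T Z \<pi> r a] assms(3)[OF i] \<pi>
      by (simp add: divide_right_mono flip: diff_divide_distrib)
    also have "\<dots> \<le> M"
      unfolding M_def using i by (intro Max_ge) auto
    finally show "1 / real T * (\<Sum>t=1..T. measure_pmf.expectation (\<rho> (z t)) (\<lambda>b. r i b (z t)))
        \<ge> 1 / real T * (\<Sum>t=1..T. measure_pmf.expectation (\<rho> (z t))
                            (\<lambda>b. r i (b(i := \<pi> (z t))) (z t))) - M"
      using sum_expectation_empirical_policy[OF assms(7), of "\<lambda>x b. r i b x"]
        sum_expectation_empirical_policy[OF assms(7), of "\<lambda>x b. r i (b(i := \<pi> x)) x"]
      by simp
  qed
  then show ?thesis
    unfolding eps_c_CCE_def by blast
qed

end
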